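(* Let $p$ be a prime number and let $n\ge 2$ be an integer. Let $l_1,\ldots,l_{(p-1)^p}\in\mathbb{Z}[x]$ be the distinct polynomials of the form $\sum_{i=0}^{p-1}a_ix^i$ with integers $0\le a_i\le p-1$ that induce the $(p-1)^p$ unit-valued (polynomial) functions on $\mathbb{Z}_p$. Then every element of $\mathcal{F}(\mathbb{Z}_{p^n})^\times$ can be uniquely represented by a polynomial of the form $$l_s(x)+\sum_{k=2}^{n}\ \sum_{i+v_p(j!)=k-1}a_{kij}\,p^i(x)_j,$$ where in the inner sum $i,j\ge 0$ are integers, $a_{kij}$ are integers with $0\le a_{kij}\le p-1$, and $s\in\{1,\ldots,(p-1)^p\}$.
   Context: $\mathbb{Z}_{m}$ denotes the ring of integers modulo $m$. A polynomial $f\in\mathbb{Z}[x]$ represents (induces) the function $r\mapsto f(r)$ on $\mathbb{Z}_{m}$. $\mathcal{F}(\mathbb{Z}_{m})$ is the commutative ring of polynomial functions on $\mathbb{Z}_m$ under pointwise operations, and $\mathcal{F}(\mathbb{Z}_m)^\times$ is its group of units, which consists exactly of the polynomial functions all of whose values are units of $\mathbb{Z}_m$ (unit-valued polynomial functions). Every function on the field $\mathbb{Z}_p$ is induced by exactly one polynomial $\sum_{i=0}^{p-1}a_ix^i$ with integers $0\le a_i\le p-1$, so the $l_s$ correspond bijectively to $\mathcal{F}(\mathbb{Z}_p)^\times$, which has $(p-1)^p$ elements. $v_p(m)$ is the largest integer $t$ such that $p^t\mid m$. $(x)_0=1$ and $(x)_j=x(x-1)\cdots(x-j+1)$ for $j\geq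 1$. *)

theory Defs
  imports
    "HOL-Number_Theory.Number_Theory"
    "HOL-Computational_Algebra.Computational_Algebra"
    "HOL-Library.FuncSet"
begin

text \<open>
  The function on \<open>\<int>\<^sub>m\<close>, with carrier \<open>{0..m - 1}\<close>, induced by an integer polynomial. It is
  restricted to the carrier, so that two polynomials induce the same function exactly if the
  values of this construction are equal in HOL.
\<close>

definition induced_fun :: "int \<Rightarrow> int poly \<Rightarrow> int \<Rightarrow> int" where
  "induced_fun m f = (\<lambda>r\<in>carrier (residue_ring m). poly f r mod m)"

definition poly_fun_ring :: "int \<Rightarrow> (int \<Rightarrow> int) ring" where
  "poly_fun_ring m =
    \<lparr>carrier = range (induced_fun m),
     mult = (\<lambda>F G. \<lambda>r\<in>carrier (residue_ring m). F r \<otimes>\<^bsub>residue_ring m\<^esub> G r),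
     one = (\<lambda>r\<in>carrier (residue_ring m). \<one>\<^bsub>residue_ring m\<^esub>),
     zero = (\<lambda>r\<in>carrier (residue_ring m). \<zero>\<^bsub>residue_ring m\<^esub>),
     add = (\<lambda>F G. \<lambda>r\<in>carrier (residue_ring m). F r \<oplus>\<^bsub>residue_ring m\<^esub> G r)\<rparr>"

text \<open>The falling factorial \<open>(x)\<^sub>j = x (x - 1) \<dots> (x - j + 1)\<close>.\<close>

definition ffact_poly :: "nat \<Rightarrow> int poly" where
  "ffact_poly j = (\<Prod>i<j. [:- int i, 1:])"

definition reduced_polys :: "nat \<Rightarrow> int poly set" where
  "reduced_polys p = {\<Sum>i<p. monom (a i) i | a. \<forall>i<p. a i \<in> {0..int p - 1}}"

definition unit_reduced_polys :: "nat \<Rightarrow> int poly set" where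
  "unit_reduced_polys p =
    {f \<in> reduced_polys p. induced_fun (int p) f \<in> Units (poly_fun_ring (int p))}"

definition level_pairs :: "nat \<Rightarrow> nat \<Rightarrow> (nat \<times> nat) set" where
  "level_pairs p t = {(i, j). i + multiplicity p (fact j) = t}"

text \<open>
  The sum over \<open>level_pairs p t\<close> is a genuine finite sum (a sum over an infinite set would
  be \<open>0\<close> by convention).
\<close>

lemma finite_level_pairs:
  assumes "prime p"
  shows "finite (level_pairs p t)"
proof -
  have p: "p \<ge> 2" using assms by (rule prime_ge_2_nat)
  have dvd: "p ^ k dvd fact (k * p)" for k
  proof (induction k)
    case (Suc k)
    have "p dvd fact p" using p by (intro dvd_fact) auto
    with Suc have "p * p ^ k dvd fact p * fact (k * p)" by (rule mult_dvd_mono[rotated])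
    also have "fact p * fact (k * p) dvd (fact (p + k * p) :: nat)"
      by (rule fact_fact_dvd_fact)
    finally show ?case by simp
  qed simp
  have "j < Suc t * p" if "multiplicity p (fact j) \<le> t" for j
  proof (rule ccontr)
    assume "\<not> j < Suc t * p"
    hence "fact (Suc t * p) dvd (fact j :: nat)" by (intro fact_dvd) simp
    hence "p ^ Suc t dvd fact j" using dvd[of "Suc t"] by (rule dvd_trans[rotated])
    hence "Suc t \<le> multiplicity p (fact j)"
      using p by (intro multiplicity_geI) auto
    with that show False by simp
  qed
  hence "level_pairs p t \<subseteq> {..t} \<times> {..<Suc t * p}"
    by (auto simp: level_pairs_def)
  thus ?thesis by (rule finite_subset) simp
qed

text \<open>
  The coefficients \<open>a\<^bsub>kij\<^esub>\<close> form a function \<open>a (k, i, j)\<close> on this index set; taking it in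
  \<open>coeff_index p n \<rightarrow>\<^sub>E {0..int p - 1}\<close>, i.e. fixed outside the index set, makes uniqueness of
  the family of coefficients meaningful.
\<close>

definition coeff_index :: "nat \<Rightarrow> nat \<Rightarrow> (nat \<times> nat \<times> nat) set" where
  "coeff_index p n = {(k, i, j). k \<in> {2..n} \<and> (i, j) \<in> level_pairs p (k - 1)}"

definition canonical_poly ::
    "nat \<Rightarrow> nat \<Rightarrow> int poly \<Rightarrow> (nat \<times> nat \<times> nat \<Rightarrow> int) \<Rightarrow> int poly" where
  "canonical_poly p n f a =
    f + (\<Sum>k=2..n. \<Sum>(i, j)\<in>level_pairs p (k - 1). smult (a (k, i, j) * int p ^ i) (ffact_poly j))"

lemma carrier_residue_ring: "carrier (residue_ring m) = {0..m - 1}"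
  by (simp add: residue_ring_def)

lemma cring_poly_fun_ring:
  assumes "m > 1"
  shows "cring (poly_fun_ring m)"
proof -
  have red: "poly f r mod m \<in> {0..m-1}" for f r using assms by simp
  have addI: "add (poly_fun_ring m) (induced_fun m f) (induced_fun m g) = induced_fun m (f + g)" for f g
    by (auto simp: poly_fun_ring_def induced_fun_def residue_ring_def mod_add_eq intro!: ext)
  have mulI: "mult (poly_fun_ring m) (induced_fun m f) (induced_fun m g) = induced_fun m (f * g)" for f g
    by (auto simp: poly_fun_ring_def induced_fun_def residue_ring_def mod_mult_eq intro!: ext)
  have oneI: "one (poly_fun_ring m) = induced_fun m 1"
    using assms by (auto simp: poly_fun_ring_def induced_fun_def residue_ring_def)
  have zeroI: "zero (poly_fun_ring m) = induced_fun m 0"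
    by (auto simp: poly_fun_ring_def induced_fun_def residue_ring_def)
  have car: "carrier (poly_fun_ring m) = range (induced_fun m)"
    by (simp add: poly_fun_ring_def)
  show ?thesis
  proof (rule cringI)
    show "abelian_group (poly_fun_ring m)"
    proof (rule abelian_groupI)
      fix x assume "x \<in> carrier (poly_fun_ring m)"
      then obtain f where f: "x = induced_fun m f" by (auto simp: car)
      show "\<exists>y\<in>carrier (poly_fun_ring m). y \<oplus>\<^bsub>poly_fun_ring m\<^esub> x = \<zero>\<^bsub>poly_fun_ring m\<^esub>"
        by (rule bexI[of _ "induced_fun m (- f)"]) (simp_all add: f addI zeroI car)
    qed (auto simp: car addI zeroI add_ac)
  next
    show "comm_monoid (poly_fun_ring m)"
      by (rule comm_monoidI) (auto simp: car mulI oneI mult_ac)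
  qed (auto simp: car addI mulI ring_distribs)
qed

text \<open>
  Over the field \<open>\<int>\<^sub>p\<close> every function is induced by exactly one reduced polynomial; in particular
  an enumeration of \<open>unit_reduced_polys p\<close> by \<open>{1..(p - 1) ^ p}\<close> exists.
\<close>

lemma poly_cong_coeffs:
  assumes "\<And>i. [coeff f i = coeff g i] (mod m)"
  shows "[poly f r = poly g (r :: int)] (mod m)"
proof -
  define d where "d = max (degree f) (degree g)"
  have "poly f r = (\<Sum>i\<le>d. coeff f i * r ^ i)"
    unfolding poly_altdef by (rule sum.mono_neutral_left) (auto simp: d_def coeff_eq_0)
  moreover have "poly g r = (\<Sum>i\<le>d. coeff g i * r ^ i)"
    unfolding poly_altdef by (rule sum.mono_neutral_left) (auto simp: d_def coeff_eq_0)
  ultimately show ?thesis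
    by (auto intro!: cong_sum cong_mult assms)
qed

lemma reduced_polys_induce_all:
  assumes "prime p" and F: "F \<in> {0..int p - 1} \<rightarrow>\<^sub>E {0..int p - 1}"
  shows "F \<in> induced_fun (int p) ` reduced_polys p"
proof -
  have p: "p \<ge> 2" using assms(1) by (rule prime_ge_2_nat)
  define h where "h = (\<Sum>r\<in>{0..int p - 1}. smult (F r) (1 - [:- r, 1:] ^ (p - 1)))"
  define g where "g = (\<Sum>i<p. monom (coeff h i mod int p) i)"
  have "degree (1 - [:- r, 1:] ^ (p - 1) :: int poly) \<le> p - 1" for r
    by (rule degree_diff_le) (auto simp: degree_linear_power)
  hence degh: "degree h \<le> p - 1"
    unfolding h_def by (intro degree_sum_le) (auto intro: order.trans[OF degree_smult_le])
  have g: "g \<in> reduced_polys p"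
    unfolding reduced_polys_def g_def using p by force
  have "[coeff g i = coeff h i] (mod int p)" for i
  proof (cases "i < p")
    case True
    thus ?thesis by (simp add: g_def coeff_sum cong_def)
  next
    case False
    moreover from this have "coeff h i = 0" using degh p by (intro coeff_eq_0) linarith
    ultimately show ?thesis by (simp add: g_def coeff_sum)
  qed
  hence gh: "[poly g r = poly h r] (mod int p)" for r by (rule poly_cong_coeffs)
  have "[poly h r = F r] (mod int p)" if r: "r \<in> {0..int p - 1}" for r
  proof -
    have "[1 - (r - q) ^ (p - 1) = (if q = r then 1 else 0)] (mod int p)"
      if q: "q \<in> {0..int p - 1}" for q
    proof (cases "q = r")
      case False
      have "\<not> int p dvd r - q"
      proof
        assume "int p dvd r - q"
        hence "[r = q] (mod int p)" by (simp add: cong_iff_dvd_diff)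
        thus False using q r False by (auto simp: cong_def)
      qed
      hence "\<not> int p dvd (r - q) mod int p" by (simp add: dvd_mod_iff)
      moreover have "int (nat ((r - q) mod int p)) = (r - q) mod int p" using p by simp
      ultimately have "\<not> p dvd nat ((r - q) mod int p)"
        by (metis int_dvd_int_iff)
      hence "[nat ((r - q) mod int p) ^ (p - 1) = 1] (mod p)"
        using assms(1) by (intro fermat_theorem)
      hence "[((r - q) mod int p) ^ (p - 1) = 1] (mod int p)"
        using \<open>int (nat ((r - q) mod int p)) = (r - q) mod int p\<close>
        by (metis cong_int_iff of_nat_1 of_nat_power)
      hence "[(r - q) ^ (p - 1) = 1] (mod int p)"
        by (simp add: cong_def power_mod)
      hence "[1 - (r - q) ^ (p - 1) = 1 - 1] (mod int p)" by (intro cong_diff) auto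
      thus ?thesis using False by simp
    qed (use p in \<open>auto simp: power_0_left\<close>)
    hence "[(\<Sum>q\<in>{0..int p - 1}. F q * (1 - (r - q) ^ (p - 1))) =
            (\<Sum>q\<in>{0..int p - 1}. F q * (if q = r then 1 else 0))] (mod int p)"
      by (intro cong_sum cong_mult) auto
    also have "(\<Sum>q\<in>{0..int p - 1}. F q * (if q = r then 1 else 0)) = F r"
      using r by (simp add: if_distrib cong: if_cong)
    finally show ?thesis by (simp add: h_def poly_sum)
  qed
  hence "[poly g r = F r] (mod int p)" if "r \<in> {0..int p - 1}" for r
    using gh that cong_trans by blast
  moreover have "F r mod int p = F r" if "r \<in> {0..int p - 1}" for r
    using PiE_mem[OF F that] by simp
  ultimately have "F = induced_fun (int p) g"
    using F unfolding induced_fun_def carrier_residue_ring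
    by (intro ext) (auto simp: cong_def PiE_def extensional_def)
  with g show ?thesis by blast
qed

lemma bij_betw_reduced_polys:
  assumes "prime p"
  shows "bij_betw (induced_fun (int p)) (reduced_polys p) ({0..int p - 1} \<rightarrow>\<^sub>E {0..int p - 1})"
proof -
  let ?A = "{..<p} \<rightarrow>\<^sub>E {0..int p - 1}"
  let ?B = "{0..int p - 1} \<rightarrow>\<^sub>E {0..int p - 1}"
  have p: "p \<ge> 2" using assms by (rule prime_ge_2_nat)
  have eq: "reduced_polys p = (\<lambda>a. \<Sum>i<p. monom (a i) i) ` ?A"
  proof
    show "reduced_polys p \<subseteq> (\<lambda>a. \<Sum>i<p. monom (a i) i) ` ?A"
    proof
      fix f assume "f \<in> reduced_polys p"
      then obtain a where a: "f = (\<Sum>i<p. monom (a i) i)" "\<forall>i<p. a i \<in> {0..int p - 1}"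
        by (auto simp: reduced_polys_def)
      show "f \<in> (\<lambda>a. \<Sum>i<p. monom (a i) i) ` ?A"
        by (rule image_eqI[of _ _ "restrict a {..<p}"]) (use a in auto)
    qed
  qed (auto simp: reduced_polys_def PiE_def Pi_def)
  have fin: "finite (reduced_polys p)" unfolding eq by (intro finite_imageI finite_PiE) auto
  have "card (reduced_polys p) \<le> card ?A"
    unfolding eq by (intro card_image_le finite_PiE) auto
  also have "\<dots> = card ?B" by (simp add: card_PiE)
  finally have le: "card (reduced_polys p) \<le> card ?B" .
  have sub: "?B \<subseteq> induced_fun (int p) ` reduced_polys p"
    using reduced_polys_induce_all[OF assms] by blast
  moreover have "induced_fun (int p) ` reduced_polys p \<subseteq> ?B"
    using p by (auto simp: induced_fun_def carrier_residue_ring)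
  ultimately have im: "induced_fun (int p) ` reduced_polys p = ?B" by blast
  hence "card (induced_fun (int p) ` reduced_polys p) = card (reduced_polys p)"
    using le card_image_le[OF fin, of "induced_fun (int p)"] by simp
  hence "inj_on (induced_fun (int p)) (reduced_polys p)" by (intro eq_card_imp_inj_on fin)
  with im show ?thesis by (simp add: bij_betw_def)
qed

lemma Units_poly_fun_ring_prime:
  assumes "prime p"
  shows "Units (poly_fun_ring (int p)) = {0..int p - 1} \<rightarrow>\<^sub>E {1..int p - 1}"
proof -
  let ?B = "{0..int p - 1} \<rightarrow>\<^sub>E {0..int p - 1}"
  have p: "p \<ge> 2" using assms by (rule prime_ge_2_nat)
  have car: "carrier (poly_fun_ring (int p)) = ?B"
  proof
    show "carrier (poly_fun_ring (int p)) \<subseteq> ?B"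
      using p by (auto simp: poly_fun_ring_def induced_fun_def carrier_residue_ring)
    show "?B \<subseteq> carrier (poly_fun_ring (int p))"
    proof
      fix F assume "F \<in> ?B"
      hence "F \<in> induced_fun (int p) ` reduced_polys p" by (rule reduced_polys_induce_all[OF assms])
      thus "F \<in> carrier (poly_fun_ring (int p))" unfolding poly_fun_ring_def by auto
    qed
  qed
  interpret cring "poly_fun_ring (int p)" using p by (intro cring_poly_fun_ring) simp
  have mul: "(F \<otimes>\<^bsub>poly_fun_ring (int p)\<^esub> G) = (\<lambda>r\<in>{0..int p - 1}. F r * G r mod int p)" for F G
    by (simp add: poly_fun_ring_def residue_ring_def)
  have one: "\<one>\<^bsub>poly_fun_ring (int p)\<^esub> = (\<lambda>r\<in>{0..int p - 1}. 1)"
    by (simp add: poly_fun_ring_def residue_ring_def)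
  show ?thesis
  proof (intro equalityI subsetI)
    fix F assume F: "F \<in> Units (poly_fun_ring (int p))"
    hence FB: "F \<in> ?B" using car Units_closed by blast
    obtain G where "F \<otimes>\<^bsub>poly_fun_ring (int p)\<^esub> G = \<one>\<^bsub>poly_fun_ring (int p)\<^esub>"
      using F by (auto simp: Units_def)
    hence eq: "(\<lambda>r\<in>{0..int p - 1}. F r * G r mod int p) = (\<lambda>r\<in>{0..int p - 1}. 1)"
      by (simp only: mul one)
    have 1: "F r * G r mod int p = 1" if "r \<in> {0..int p - 1}" for r
      using fun_cong[OF eq, of r] that by simp
    have "F r \<in> {1..int p - 1}" if "r \<in> {0..int p - 1}" for r
      using 1[OF that] PiE_mem[OF FB that] by (cases "F r = 0") auto
    thus "F \<in> {0..int p - 1} \<rightarrow>\<^sub>E {1..int p - 1}"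
      using FB by (auto simp: PiE_def)
  next
    fix F assume F: "F \<in> {0..int p - 1} \<rightarrow>\<^sub>E {1..int p - 1}"
    have "\<exists>y. [F r * y = 1] (mod int p)" if "r \<in> {0..int p - 1}" for r
    proof (rule cong_solve_coprime_int)
      have "F r \<in> {1..int p - 1}" using F that by (rule PiE_mem)
      hence "\<not> int p dvd F r" by (auto dest: zdvd_imp_le)
      moreover have "prime (int p)" using assms by simp
      ultimately show "coprime (F r) (int p)"
        using prime_imp_coprime coprime_commute by blast
    qed
    then obtain y where y: "\<And>r. r \<in> {0..int p - 1} \<Longrightarrow> [F r * y r = 1] (mod int p)" by metis
    define G where "G = (\<lambda>r\<in>{0..int p - 1}. y r mod int p)"
    have G: "G \<in> carrier (poly_fun_ring (int p))" using p by (auto simp: car G_def)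
    have FB: "F \<in> carrier (poly_fun_ring (int p))" unfolding car
      using F PiE_mono[of "{0..int p - 1}" "\<lambda>_. {1..int p - 1}" "\<lambda>_. {0..int p - 1}"] by auto
    have "F \<otimes>\<^bsub>poly_fun_ring (int p)\<^esub> G = \<one>\<^bsub>poly_fun_ring (int p)\<^esub>"
      unfolding mul one
    proof (rule restrict_ext)
      fix r assume r: "r \<in> {0..int p - 1}"
      hence "F r * G r mod int p = F r * y r mod int p" by (simp add: G_def mod_mult_right_eq)
      thus "F r * G r mod int p = 1" using y[OF r] p by (simp add: cong_def)
    qed
    thus "F \<in> Units (poly_fun_ring (int p))"
      using FB G m_comm[OF FB G] by (auto simp: Units_def)
  qed
qed

lemma card_unit_reduced_polys:
  assumes "prime p"
  shows "card (unit_reduced_polys p) = (p - 1) ^ p"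
proof -
  let ?U = "Units (poly_fun_ring (int p))"
  have U: "?U = {0..int p - 1} \<rightarrow>\<^sub>E {1..int p - 1}" by (rule Units_poly_fun_ring_prime[OF assms])
  have "?U \<subseteq> {0..int p - 1} \<rightarrow>\<^sub>E {0..int p - 1}" unfolding U by (rule PiE_mono) auto
  hence "?U \<subseteq> induced_fun (int p) ` reduced_polys p"
    using bij_betw_reduced_polys[OF assms] by (simp add: bij_betw_def)
  hence im: "induced_fun (int p) ` unit_reduced_polys p = ?U"
    by (auto simp: unit_reduced_polys_def)
  have "inj_on (induced_fun (int p)) (unit_reduced_polys p)"
    using bij_betw_reduced_polys[OF assms]
    by (rule inj_on_subset[OF bij_betw_imp_inj_on]) (auto simp: unit_reduced_polys_def)
  hence "card (unit_reduced_polys p) = card ?U" using im card_image by metis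
  also have "\<dots> = (p - 1) ^ p" unfolding U by (simp add: card_PiE nat_diff_distrib)
  finally show ?thesis .
qed

end

theory Submission
  imports Defs
begin

text \<open>
  Every integer polynomial is an integer combination \<open>\<Sum>\<^sub>j c\<^sub>j (x)\<^sub>j\<close>, and Newton
  interpolation shows that \<open>m\<close> divides all its values iff \<open>m\<close> divides every \<open>c\<^sub>j j!\<close>.
  Hence if \<open>p\<^sup>t\<close> divides all values, then \<open>c\<^sub>j = p\<^sup>i d\<^sub>j\<close> whenever \<open>i + v\<^sub>p(j!) = t\<close>, and
  subtracting the terms \<open>(d\<^sub>j mod p) p\<^sup>i (x)\<^sub>j\<close> makes all values divisible by \<open>p\<^sup>t\<^sup>+\<^sup>1\<close>;
  no other choice of digits does. The reduction modulo \<open>p\<close> determines \<open>l\<^sub>s\<close>, and the digits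
  are then determined one level at a time.
\<close>

section \<open>Newton expansion in falling factorials\<close>

lemma poly_ffact_poly_nat:
  "poly (ffact_poly j) (int r) = fact j * int (r choose j)"
proof (induction j)
  case (Suc j)
  have "Suc j * (r choose Suc j) = (r - j) * (r choose j)"
    by (metis binomial_absorb_comp binomial_absorption)
  hence "int (Suc j) * int (r choose Suc j) = int (r - j) * int (r choose j)"
    by (metis of_nat_mult)
  \<comment> \<open>For \<open>j > r\<close> the truncated difference \<open>r - j\<close> is
    harmless because \<open>r choose j\<close> vanishes.\<close>
  also have "\<dots> = (int r - int j) * int (r choose j)"
    by (cases "j \<le> r") auto
  finally have "fact j * (int (Suc j) * int (r choose Suc j)) =
      fact j * ((int r - int j) * int (r choose j))" by simp
  moreover have "poly (ffact_poly (Suc j)) (int r) =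
      poly (ffact_poly j) (int r) * (int r - int j)"
    by (simp add: ffact_poly_def algebra_simps)
  ultimately show ?case by (simp add: Suc.IH mult_ac)
qed (simp add: ffact_poly_def)

text \<open>Multiplication by x acts on the basis by x (x)_j = (x)_(j+1) + j (x)_j, which suits
  induction on \<open>pCons\<close>. Cutting the sum at \<open>r\<close> instead of the degree loses
  nothing, since (x)_j vanishes at every natural \<open>r < j\<close>.\<close>

lemma newton_expansion:
  fixes g :: "int poly"
  shows "\<exists>c. \<forall>r. poly g (int r) = (\<Sum>j\<le>r. c j * poly (ffact_poly j) (int r))"
proof (induction g)
  case 0
  show ?case by (rule exI[of _ "\<lambda>_. 0"]) simp
next
  case (pCons a g)
  then obtain c where c: "\<And>r. poly g (int r) = (\<Sum>j\<le>r. c j * poly (ffact_poly j) (int r))"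
    by blast
  \<comment> \<open>The first summand collects the constant \<open>a\<close> and the shifted
    coefficients from (x)_(j+1), the second the term j (x)_j.\<close>
  define c' where "c' j = (if j = 0 then a else c (j - 1)) + int j * c j" for j
  have "poly (pCons a g) (int r) = (\<Sum>j\<le>r. c' j * poly (ffact_poly j) (int r))" for r
  proof -
    let ?f = "\<lambda>j. poly (ffact_poly j) (int r)"
    have rec: "int r * ?f j = ?f (Suc j) + int j * ?f j" for j
      by (simp add: ffact_poly_def algebra_simps)
    \<comment> \<open>The shift creates a term of index \<open>Suc r\<close>; this removes it
      again.\<close>
    have z: "?f (Suc r) = 0" by (simp add: poly_ffact_poly_nat)
    have "poly (pCons a g) (int r) = a + (\<Sum>j\<le>r. c j * (int r * ?f j))"
      by (simp add: c sum_distrib_left algebra_simps)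
    also have "\<dots> = a + (\<Sum>j\<le>r. c j * ?f (Suc j)) + (\<Sum>j\<le>r. int j * c j * ?f j)"
      by (simp add: rec sum.distrib algebra_simps)
    also have "a + (\<Sum>j\<le>r. c j * ?f (Suc j)) =
        (\<Sum>j\<le>Suc r. (if j = 0 then a else c (j - 1)) * ?f j)"
      by (subst sum.atMost_Suc_shift) (simp add: ffact_poly_def)
    also have "\<dots> = (\<Sum>j\<le>r. (if j = 0 then a else c (j - 1)) * ?f j)"
      by (simp add: z)
    finally show ?thesis by (simp add: c'_def sum.distrib algebra_simps)
  qed
  thus ?case by blast
qed

text \<open>The system is triangular: at \<open>r = k\<close> the last term is
  \<open>c k * fact k\<close>, and each earlier one is a multiple of some
  \<open>c j * fact j\<close> already known to be divisible by \<open>m\<close>.\<close>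

lemma newton_coeff_dvd:
  fixes m :: int
  assumes "\<And>r. m dvd (\<Sum>j\<le>r. c j * poly (ffact_poly j) (int r))"
  shows "m dvd c k * fact k"
proof (induction k rule: less_induct)
  case (less k)
  have "m dvd (\<Sum>j<k. c j * poly (ffact_poly j) (int k))"
  proof (rule dvd_sum)
    fix j assume "j \<in> {..<k}"
    hence "m dvd c j * fact j" using less by simp
    thus "m dvd c j * poly (ffact_poly j) (int k)"
      by (simp add: poly_ffact_poly_nat dvd_mult2 flip: mult.assoc)
  qed
  moreover have "(\<Sum>j\<le>k. c j * poly (ffact_poly j) (int k)) =
      (\<Sum>j<k. c j * poly (ffact_poly j) (int k)) + c k * fact k"
    by (simp add: poly_ffact_poly_nat flip: lessThan_Suc_atMost)
  ultimately show ?case using assms[of k] by (simp add: dvd_add_right_iff)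
qed

section \<open>A single level: digits at a fixed power of p\<close>

lemma fact_prime_decomp:
  assumes "prime p"
  obtains u :: int where "fact j = int p ^ multiplicity p (fact j :: nat) * u" "\<not> int p dvd u"
proof -
  obtain y :: nat where y: "fact j = p ^ multiplicity p (fact j :: nat) * y" "\<not> p dvd y"
    using assms by (rule_tac multiplicity_decompose'[of "fact j" p]) (auto simp: not_prime_unit)
  have "(fact j :: int) = int (fact j)" by simp
  also have "\<dots> = int p ^ multiplicity p (fact j :: nat) * int y"
    by (subst y(1)) simp
  finally show ?thesis using y(2) that[of "int y"] by simp
qed

text \<open>The inner sum of \<open>canonical_poly\<close> for \<open>k = t + 1\<close>, isolated so
  that levels can be treated one at a time.\<close>

definition level_poly :: "nat \<Rightarrow> nat \<Rightarrow> (nat \<times> nat \<Rightarrow> int) \<Rightarrow> int poly" where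
  "level_poly p t b = (\<Sum>(i, j)\<in>level_pairs p t. smult (b (i, j) * int p ^ i) (ffact_poly j))"

lemma level_poly_diff: "level_poly p t (\<lambda>x. b x - b' x) = level_poly p t b - level_poly p t b'"
  by (simp add: level_poly_def case_prod_unfold left_diff_distrib smult_diff_left
      flip: sum_subtractf)

lemma level_poly_cong:
  "(\<And>x. x \<in> level_pairs p t \<Longrightarrow> b x = b' x) \<Longrightarrow> level_poly p t b = level_poly p t b'"
  unfolding level_poly_def by (rule sum.cong) auto

lemma canonical_poly_level:
  "canonical_poly p n f a = f + (\<Sum>k=2..n. level_poly p (k - 1) (\<lambda>x. a (k, x)))"
  by (simp add: canonical_poly_def level_poly_def)

text \<open>On a level, \<open>j\<close> determines \<open>i = t - v\<close>, so the sum over pairs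
  becomes a Newton sum over \<open>j\<close> alone. Indices with \<open>v > t\<close> belong to no
  pair and get coefficient 0.\<close>

lemma poly_level_poly:
  assumes "prime p"
  shows "poly (level_poly p t b) (int r) =
    (\<Sum>j\<le>r. (let v = multiplicity p (fact j :: nat) in
        if v \<le> t then b (t - v, j) * int p ^ (t - v) else 0) * poly (ffact_poly j) (int r))"
proof -
  let ?v = "\<lambda>j. multiplicity p (fact j :: nat)"
  let ?J = "{j. ?v j \<le> t}"
  let ?c = "\<lambda>j. b (t - ?v j, j) * int p ^ (t - ?v j) * poly (ffact_poly j) (int r)"
  have bij: "bij_betw (\<lambda>j. (t - ?v j, j)) ?J (level_pairs p t)"
    by (rule bij_betw_byWitness[of _ snd]) (auto simp: level_pairs_def)
  have fin: "finite ?J"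
    using bij_betw_finite[OF bij] finite_level_pairs[OF assms] by simp
  have "poly (level_poly p t b) (int r) =
      (\<Sum>(i, j)\<in>level_pairs p t. b (i, j) * int p ^ i * poly (ffact_poly j) (int r))"
    by (simp add: level_poly_def poly_sum case_prod_unfold)
  also have "\<dots> = (\<Sum>j\<in>?J. ?c j)"
    using sum.reindex_bij_betw[OF bij,
        of "\<lambda>(i, j). b (i, j) * int p ^ i * poly (ffact_poly j) (int r)"] by simp
  \<comment> \<open>The terms with \<open>j > r\<close> vanish at \<open>r\<close>.\<close>
  also have "\<dots> = (\<Sum>j\<in>?J \<inter> {..r}. ?c j)"
    by (rule sum.mono_neutral_right) (use fin in \<open>auto simp: poly_ffact_poly_nat\<close>)
  also have "\<dots> = (\<Sum>j\<le>r. if j \<in> ?J then ?c j else 0)"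
    by (simp add: Int_commute sum.inter_restrict)
  finally show ?thesis by (simp add: Let_def if_distrib[of "\<lambda>x. x * _"] cong: if_cong)
qed

text \<open>Each value of (x)_j contains the factor j!, hence \<open>p ^ v\<close>; the remaining
  \<open>p ^ i\<close> stands in the coefficient.\<close>

lemma level_poly_dvd:
  assumes "prime p"
  shows "int p ^ t dvd poly (level_poly p t b) (int r)"
proof -
  have "int p ^ t dvd b (i, j) * int p ^ i * poly (ffact_poly j) (int r)"
    if "(i, j) \<in> level_pairs p t" for i j
  proof -
    obtain u :: int where "fact j = int p ^ multiplicity p (fact j :: nat) * u"
      using fact_prime_decomp[OF assms] by blast
    moreover have "t = i + multiplicity p (fact j :: nat)"
      using that by (simp add: level_pairs_def)
    ultimately have "b (i, j) * int p ^ i * poly (ffact_poly j) (int r) =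
        int p ^ t * (b (i, j) * u * int (r choose j))"
      by (simp add: poly_ffact_poly_nat power_add)
    thus ?thesis by (rule dvdI)
  qed
  thus ?thesis
    by (auto simp: level_poly_def poly_sum intro!: dvd_sum)
qed

lemma level_poly_digits_exist:
  assumes p: "prime p" and g: "\<And>r. int p ^ t dvd poly g (int r)"
  shows "\<exists>b. range b \<subseteq> {0..int p - 1} \<and>
    (\<forall>r. int p ^ Suc t dvd poly (g - level_poly p t b) (int r))"
proof -
  have p0: "p > 0" using p by (rule prime_gt_0_nat)
  obtain c where c: "\<And>r. poly g (int r) = (\<Sum>j\<le>r. c j * poly (ffact_poly j) (int r))"
    using newton_expansion by blast
  \<comment> \<open>On pairs of level \<open>t\<close> the division proves to be exact, and the
    remainder is the lowest base-p digit of the quotient.\<close>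
  define b where "b = (\<lambda>(i, j). (c j div int p ^ i) mod int p)"
  let ?v = "\<lambda>j. multiplicity p (fact j :: nat)"
  let ?e = "\<lambda>j. let v = ?v j in if v \<le> t then b (t - v, j) * int p ^ (t - v) else 0"
  have coeff: "int p ^ Suc t dvd (c j - ?e j) * fact j" for j
  proof -
    obtain u :: int where u: "fact j = int p ^ ?v j * u" "\<not> int p dvd u"
      using fact_prime_decomp[OF p] by blast
    show ?thesis
    proof (cases "?v j \<le> t")
      case True
      define i where "i = t - ?v j"
      have t: "t = i + ?v j" using True by (simp add: i_def)
      have "int p ^ t dvd c j * fact j"
        by (rule newton_coeff_dvd) (use g c in simp)
      \<comment> \<open>Cancelling the p-part of j!, and then its cofactor \<open>u\<close> prime to
        p, leaves \<open>p ^ i\<close> dividing \<open>c j\<close>.\<close>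
      hence "int p ^ ?v j * int p ^ i dvd int p ^ ?v j * (c j * u)"
        by (subst (asm) u(1)) (simp add: t power_add mult_ac)
      hence "int p ^ i dvd c j * u" using p0 by simp
      moreover have "coprime (int p ^ i) u"
        using p u(2) by (simp add: prime_imp_coprime)
      ultimately have "int p ^ i dvd c j" by (simp add: coprime_dvd_mult_left_iff)
      then obtain d where d: "c j = int p ^ i * d" by blast
      have "c j - ?e j = int p ^ i * (d - d mod int p)"
        using True p0 by (simp add: Let_def b_def d algebra_simps flip: i_def)
      moreover have "d - d mod int p = int p * (d div int p)"
        by (simp add: minus_mod_eq_mult_div)
      ultimately have "(c j - ?e j) * fact j = int p ^ Suc t * (d div int p * u)"
        by (subst u(1)) (simp add: t power_add mult_ac)
      thus ?thesis by simp
    next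
      case False
      \<comment> \<open>No digit is available for this \<open>j\<close>, but j! alone already
        supplies \<open>p ^ Suc t\<close>.\<close>
      hence "int p ^ Suc t dvd int p ^ ?v j" by (intro le_imp_power_dvd) simp
      hence "int p ^ Suc t dvd fact j" by (subst u(1)) (rule dvd_mult2)
      thus ?thesis by (rule dvd_mult)
    qed
  qed
  have "int p ^ Suc t dvd poly (g - level_poly p t b) (int r)" for r
  proof -
    have "poly (g - level_poly p t b) (int r) =
        (\<Sum>j\<le>r. (c j - ?e j) * fact j * int (r choose j))"
      by (simp only: poly_diff c poly_level_poly[OF p] sum_subtractf[symmetric]
          left_diff_distrib[symmetric] poly_ffact_poly_nat mult.assoc)
    also have "int p ^ Suc t dvd \<dots>" by (intro dvd_sum dvd_mult2 coeff)
    finally show ?thesis .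
  qed
  moreover have "range b \<subseteq> {0..int p - 1}" using p0 by (auto simp: b_def)
  ultimately show ?thesis by blast
qed

text \<open>The Newton coefficient at \<open>j\<close> is \<open>b (i, j) * p ^ i\<close>. Times j!
  it contributes exactly \<open>p ^ t\<close> apart from \<open>b (i, j)\<close>, so the extra
  factor p must divide the digit. Here \<open>b\<close> is arbitrary, so it may be a difference of
  two digit families.\<close>

lemma level_poly_digits_unique:
  assumes p: "prime p" and dvd: "\<And>r. int p ^ Suc t dvd poly (level_poly p t b) (int r)"
    and ij: "(i, j) \<in> level_pairs p t"
  shows "int p dvd b (i, j)"
proof -
  have p0: "p > 0" using p by (rule prime_gt_0_nat)
  let ?v = "multiplicity p (fact j :: nat)"
  have t: "t = i + ?v" using ij by (simp add: level_pairs_def)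
  obtain u :: int where u: "fact j = int p ^ ?v * u" "\<not> int p dvd u"
    using fact_prime_decomp[OF p] by blast
  have "int p ^ Suc t dvd (let v = ?v in
      if v \<le> t then b (t - v, j) * int p ^ (t - v) else 0) * fact j"
    by (rule newton_coeff_dvd) (use dvd in \<open>simp only: poly_level_poly[OF p]\<close>)
  hence "int p ^ Suc t dvd b (i, j) * int p ^ i * fact j" by (simp add: t)
  hence "int p ^ t * int p dvd int p ^ t * (b (i, j) * u)"
    by (subst (asm) u(1)) (simp add: t power_add mult_ac)
  hence "int p dvd b (i, j) * u" using p0 by simp
  thus ?thesis using p u(2) by (simp add: prime_dvd_mult_iff)
qed

section \<open>Expansion through all levels\<close>

lemma level_expansion_exists:
  assumes p: "prime p" and g: "\<And>r. int p dvd poly g (int r)" and "n \<ge> 1"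
  shows "\<exists>a. range a \<subseteq> {0..int p - 1} \<and>
    (\<forall>r. int p ^ n dvd poly (g - (\<Sum>k=2..n. level_poly p (k - 1) (\<lambda>x. a (k, x)))) (int r))"
  using \<open>n \<ge> 1\<close>
proof (induction n rule: dec_induct)
  \<comment> \<open>For \<open>n = 1\<close> the sum over levels is empty and the claim is the
    assumption on \<open>g\<close>.\<close>
  case base
  show ?case
    by (rule exI[of _ "\<lambda>_. 0"]) (use g prime_gt_0_nat[OF p] in auto)
next
  case (step n)
  then obtain a where a: "range a \<subseteq> {0..int p - 1}"
    "\<And>r. int p ^ n dvd poly (g - (\<Sum>k=2..n. level_poly p (k - 1) (\<lambda>x. a (k, x)))) (int r)"
    by blast
  obtain b where b: "range b \<subseteq> {0..int p - 1}"
    "\<And>r. int p ^ Suc n dvd poly (g - (\<Sum>k=2..n. level_poly p (k - 1) (\<lambda>x. a (k, x)))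
        - level_poly p n b) (int r)"
    using level_poly_digits_exist[OF p a(2)] by blast
  \<comment> \<open>The new digits occupy only \<open>k = Suc n\<close>, so the levels already
    treated are unchanged.\<close>
  define a' where "a' = (\<lambda>(k, x). if k = Suc n then b x else a (k, x))"
  have "(\<Sum>k=2..Suc n. level_poly p (k - 1) (\<lambda>x. a' (k, x))) =
      (\<Sum>k=2..n. level_poly p (k - 1) (\<lambda>x. a (k, x))) + level_poly p n b"
    using \<open>1 \<le> n\<close> by (simp add: a'_def)
  moreover have "range a' \<subseteq> {0..int p - 1}" using a(1) b(1)
    by (simp add: a'_def image_subset_iff)
  ultimately show ?case using b(2)
    by (intro exI[of _ a']) (simp add: diff_diff_eq del: power_Suc)
qed

text \<open>Linearity reduces the claim to the digit differences \<open>d\<close>. By strong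
  induction on \<open>k\<close>, lower levels vanish and higher ones are divisible by
  \<open>p ^ k\<close>; hence level \<open>k\<close> alone is divisible by \<open>p ^ k\<close>, one
  power more than it has automatically.\<close>

lemma level_expansion_unique:
  assumes p: "prime p"
    and a: "a \<in> coeff_index p n \<rightarrow>\<^sub>E {0..int p - 1}"
    and a': "a' \<in> coeff_index p n \<rightarrow>\<^sub>E {0..int p - 1}"
    and dvd: "\<And>r. int p ^ n dvd poly ((\<Sum>k=2..n. level_poly p (k - 1) (\<lambda>x. a (k, x))) -
        (\<Sum>k=2..n. level_poly p (k - 1) (\<lambda>x. a' (k, x)))) (int r)"
  shows "a = a'"
proof -
  define d where "d x = a x - a' x" for x
  let ?L = "\<lambda>k. level_poly p (k - 1) (\<lambda>x. d (k, x))"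
  have dvd': "int p ^ n dvd (\<Sum>k=2..n. poly (?L k) (int r))" for r
    using dvd[of r] by (simp add: d_def level_poly_diff poly_sum sum_subtractf)
  have zero: "d (k, x) = 0" if "k \<in> {2..n}" "x \<in> level_pairs p (k - 1)" for k x
    using that
  proof (induction k arbitrary: x rule: less_induct)
    case (less k)
    have k: "Suc (k - 1) = k" using less.prems by simp
    have lead: "int p ^ Suc (k - 1) dvd poly (?L k) (int r)" for r
    proof -
      have "int p ^ k dvd (\<Sum>q\<in>{2..n} - {k}. poly (?L q) (int r))"
      proof (rule dvd_sum)
        fix q assume q: "q \<in> {2..n} - {k}"
        show "int p ^ k dvd poly (?L q) (int r)"
        proof (cases "q < k")
          case True
          have "?L q = level_poly p (q - 1) (\<lambda>_. 0)"
            by (rule level_poly_cong) (use less.IH[OF True] q in auto)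
          thus ?thesis by (simp add: level_poly_def)
        next
          case False
          \<comment> \<open>Since \<open>q \<noteq> k\<close>, here
            \<open>q - 1 \<ge> k\<close>.\<close>
          hence "int p ^ k dvd int p ^ (q - 1)" using q by (intro le_imp_power_dvd) auto
          thus ?thesis using level_poly_dvd[OF p] by (rule dvd_trans)
        qed
      qed
      moreover have "int p ^ k dvd (\<Sum>q=2..n. poly (?L q) (int r))"
        using less.prems by (intro dvd_trans[OF le_imp_power_dvd dvd']) auto
      moreover have "(\<Sum>q=2..n. poly (?L q) (int r)) =
          poly (?L k) (int r) + (\<Sum>q\<in>{2..n} - {k}. poly (?L q) (int r))"
        using less.prems by (intro sum.remove) auto
      ultimately show ?thesis unfolding k by (simp only: dvd_add_left_iff)
    qed
    have "int p dvd d (k, x)"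
      using less.prems(2) level_poly_digits_unique[OF p lead, of "fst x" "snd x"] by simp
    moreover have "(k, x) \<in> coeff_index p n"
      using less.prems by (cases x) (simp add: coeff_index_def)
    hence "a (k, x) \<in> {0..int p - 1}" "a' (k, x) \<in> {0..int p - 1}"
      using a a' by (auto dest: PiE_mem)
    hence "\<bar>d (k, x)\<bar> < int p" by (auto simp: d_def)
    \<comment> \<open>A multiple of p of absolute value below p is 0.\<close>
    ultimately show ?case using zdvd_not_zless[of "\<bar>d (k, x)\<bar>" "int p"] by auto
  qed
  show ?thesis
  proof (rule PiE_ext[OF a a'])
    fix x assume "x \<in> coeff_index p n"
    thus "a x = a' x" using zero by (auto simp: coeff_index_def d_def)
  qed
qed

section \<open>Induced functions and reduction modulo p\<close>

lemma cong_poly: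
  fixes f :: "int poly"
  assumes "[x = y] (mod m)"
  shows "[poly f x = poly f y] (mod m)"
  by (induction f) (auto intro!: cong_add cong_mult assms)

text \<open>Every residue class has a natural representative and polynomials respect congruences.
  Testing at natural arguments is the form the Newton lemmas require.\<close>

lemma induced_fun_eq_iff:
  assumes "m > 0"
  shows "induced_fun m f = induced_fun m g \<longleftrightarrow> (\<forall>r. m dvd poly (f - g) (int r))"
proof
  assume eq: "induced_fun m f = induced_fun m g"
  show "\<forall>r. m dvd poly (f - g) (int r)"
  proof
    fix r
    let ?s = "int r mod m"
    have "poly f ?s mod m = poly g ?s mod m"
      using fun_cong[OF eq, of ?s] assms by (simp add: induced_fun_def carrier_residue_ring)
    hence "m dvd poly (f - g) ?s" by (simp add: mod_eq_dvd_iff)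
    moreover have "[poly (f - g) ?s = poly (f - g) (int r)] (mod m)"
      by (rule cong_poly) (simp add: cong_def)
    ultimately show "m dvd poly (f - g) (int r)" using cong_dvd_iff by blast
  qed
next
  assume dvd: "\<forall>r. m dvd poly (f - g) (int r)"
  show "induced_fun m f = induced_fun m g"
    unfolding induced_fun_def carrier_residue_ring
  proof (rule restrict_ext)
    fix r assume "r \<in> {0..m - 1}"
    thus "poly f r mod m = poly g r mod m"
      using dvd[rule_format, of "nat r"] by (simp add: mod_eq_dvd_iff)
  qed
qed

text \<open>An inverse modulo \<open>p ^ n\<close> is induced by some \<open>g\<close>, and f(r)
  g(r) = 1 persists modulo p, so no value of \<open>f\<close> is divisible by p.\<close>

lemma unit_induced_fun_mod_prime:
  assumes p: "prime p" and n: "n \<ge> 1"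
    and unit: "induced_fun (int p ^ n) f \<in> Units (poly_fun_ring (int p ^ n))"
  shows "induced_fun (int p) f \<in> Units (poly_fun_ring (int p))"
proof -
  let ?m = "int p ^ n" and ?R = "poly_fun_ring (int p ^ n)"
  have p2: "p \<ge> 2" using p by (rule prime_ge_2_nat)
  have pm: "int p dvd ?m" using n by simp
  have "p \<le> p ^ n" using n p2 by (simp add: self_le_power)
  hence ple: "int p \<le> ?m" by (metis of_nat_le_iff of_nat_power)
  obtain G where G: "G \<in> carrier ?R" "induced_fun ?m f \<otimes>\<^bsub>?R\<^esub> G = \<one>\<^bsub>?R\<^esub>"
    using unit by (auto simp: Units_def)
  obtain g where g: "G = induced_fun ?m g" using G(1) by (auto simp: poly_fun_ring_def)
  have "poly f r mod int p \<noteq> 0" if r: "r \<in> {0..int p - 1}" for r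
  proof
    assume "poly f r mod int p = 0"
    hence "int p dvd poly f r * poly g r" by (simp add: dvd_eq_mod_eq_0 mod_mult_left_eq[symmetric])
    \<comment> \<open>The restricted functions can be evaluated at \<open>r\<close> only inside the
      larger carrier.\<close>
    moreover have "r \<in> {0..?m - 1}" using r order.trans[OF _ diff_right_mono[OF ple, of 1]] by simp
    hence "(poly f r mod ?m) * (poly g r mod ?m) mod ?m = 1"
      using fun_cong[OF G(2), of r]
      by (simp add: g poly_fun_ring_def induced_fun_def residue_ring_def split: if_splits)
    hence "[poly f r * poly g r = 1] (mod ?m)"
      using p2 n by (simp add: cong_def mod_mult_eq)
    hence "[poly f r * poly g r = 1] (mod int p)" using pm by (rule cong_dvd_modulus)
    ultimately have "int p dvd 1" using cong_dvd_iff by blast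
    thus False using p2 by simp
  qed
  hence "poly f r mod int p \<in> {1..int p - 1}" if "r \<in> {0..int p - 1}" for r
    using that p2 pos_mod_sign[of "int p" "poly f r"] pos_mod_bound[of "int p" "poly f r"]
    by (smt (verit) atLeastAtMost_iff of_nat_less_0_iff)
  thus ?thesis
    unfolding Units_poly_fun_ring_prime[OF p] by (auto simp: induced_fun_def carrier_residue_ring)
qed

section \<open>Existence and uniqueness of the canonical representation\<close>

text \<open>Take for \<open>h\<close> the reduced polynomial agreeing with \<open>f\<close> modulo
  p; then \<open>f - h\<close> has all values divisible by p and can be expanded level by
  level.\<close>

lemma canonical_poly_exists:
  assumes p: "prime p" and n: "n \<ge> 1"
    and unit: "induced_fun (int p ^ n) f \<in> Units (poly_fun_ring (int p ^ n))"
  shows "\<exists>h\<in>unit_reduced_polys p. \<exists>a\<in>coeff_index p n \<rightarrow>\<^sub>E {0..int p - 1}.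
    induced_fun (int p ^ n) (canonical_poly p n h a) = induced_fun (int p ^ n) f"
proof -
  have p0: "p > 0" using p by (rule prime_gt_0_nat)
  have U: "induced_fun (int p) f \<in> Units (poly_fun_ring (int p))"
    by (rule unit_induced_fun_mod_prime[OF p n unit])
  hence "induced_fun (int p) f \<in> {0..int p - 1} \<rightarrow>\<^sub>E {0..int p - 1}"
    unfolding Units_poly_fun_ring_prime[OF p] by (rule subsetD[OF PiE_mono, rotated]) auto
  then obtain h where h: "h \<in> reduced_polys p" "induced_fun (int p) f = induced_fun (int p) h"
    using reduced_polys_induce_all[OF p] by blast
  have hU: "h \<in> unit_reduced_polys p" using h U by (simp add: unit_reduced_polys_def)
  have "int p dvd poly (f - h) (int r)" for r
    using h(2) p0 by (simp add: induced_fun_eq_iff)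
  then obtain a where a: "range a \<subseteq> {0..int p - 1}"
    "\<And>r. int p ^ n dvd poly (f - h - (\<Sum>k=2..n. level_poly p (k - 1) (\<lambda>x. a (k, x)))) (int r)"
    using level_expansion_exists[OF p _ n] by meson
  \<comment> \<open>Restriction makes the family extensional; the levels read only digits inside the
    index set.\<close>
  define a' where "a' = restrict a (coeff_index p n)"
  have "(\<Sum>k=2..n. level_poly p (k - 1) (\<lambda>x. a (k, x))) =
      (\<Sum>k=2..n. level_poly p (k - 1) (\<lambda>x. a' (k, x)))"
    by (intro sum.cong refl level_poly_cong) (auto simp: a'_def coeff_index_def)
  hence "f - canonical_poly p n h a' =
      f - h - (\<Sum>k=2..n. level_poly p (k - 1) (\<lambda>x. a (k, x)))"
    by (simp add: canonical_poly_level)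
  hence "induced_fun (int p ^ n) f = induced_fun (int p ^ n) (canonical_poly p n h a')"
    using a(2) p0 by (simp only: induced_fun_eq_iff zero_less_power of_nat_0_less_iff) simp
  moreover have "a' \<in> coeff_index p n \<rightarrow>\<^sub>E {0..int p - 1}"
    unfolding a'_def restrict_PiE_iff Pi_iff using a(1) by blast
  ultimately show ?thesis using hU by (metis (no_types))
qed

text \<open>Modulo p only the reduced parts survive, so \<open>h = h'\<close> by injectivity on
  reduced polynomials; cancelling them leaves the uniqueness of digits.\<close>

lemma canonical_poly_unique:
  assumes p: "prime p" and n: "n \<ge> 1"
    and h: "h \<in> reduced_polys p" "h' \<in> reduced_polys p"
    and a: "a \<in> coeff_index p n \<rightarrow>\<^sub>E {0..int p - 1}" "a' \<in> coeff_index p n \<rightarrow>\<^sub>E {0..int p - 1}"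
    and eq: "induced_fun (int p ^ n) (canonical_poly p n h a) =
      induced_fun (int p ^ n) (canonical_poly p n h' a')"
  shows "h = h' \<and> a = a'"
proof -
  have p0: "p > 0" using p by (rule prime_gt_0_nat)
  let ?S = "\<lambda>a. \<Sum>k=2..n. level_poly p (k - 1) (\<lambda>x. a (k, x))"
  have dvd: "int p ^ n dvd poly (h + ?S a - (h' + ?S a')) (int r)" for r
    using eq p0 by (simp only: induced_fun_eq_iff zero_less_power of_nat_0_less_iff
        canonical_poly_level)
  have S: "int p dvd poly (?S a) (int r)" for a r
    unfolding poly_sum
  proof (rule dvd_sum)
    fix k assume "k \<in> {2..n}"
    \<comment> \<open>The levels start at \<open>k = 2\<close>, so the exponent is positive.\<close>
    hence "int p dvd int p ^ (k - 1)" by simp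
    thus "int p dvd poly (level_poly p (k - 1) (\<lambda>x. a (k, x))) (int r)"
      using level_poly_dvd[OF p] by (rule dvd_trans)
  qed
  have "int p dvd poly (h - h') (int r)" for r
  proof -
    have 1: "int p dvd poly (h + ?S a - (h' + ?S a')) (int r)"
      using n by (intro dvd_trans[OF _ dvd]) simp
    have 2: "poly (h - h') (int r) = poly (h + ?S a - (h' + ?S a')) (int r)
        - poly (?S a) (int r) + poly (?S a') (int r)" by simp
    show ?thesis unfolding 2 by (intro dvd_add dvd_diff 1 S[of a] S[of a'])
  qed
  hence "induced_fun (int p) h = induced_fun (int p) h'" using p0 by (simp add: induced_fun_eq_iff)
  hence hh: "h = h'"
    using bij_betw_imp_inj_on[OF bij_betw_reduced_polys[OF p]] h by (auto dest: inj_onD)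
  have "int p ^ n dvd poly (?S a - ?S a') (int r)" for r
    using dvd[of r] hh by simp
  thus ?thesis using hh level_expansion_unique[OF p a] by blast
qed

theorem theorem5p10:
  fixes p n :: nat and l :: "nat \<Rightarrow> int poly"
  assumes "prime p" and "n \<ge> 2"
    and "bij_betw l {1..(p - 1) ^ p} (unit_reduced_polys p)"
  shows "\<forall>F \<in> Units (poly_fun_ring (int p ^ n)).
    \<exists>!sa. sa \<in> {1..(p - 1) ^ p} \<times> (coeff_index p n \<rightarrow>\<^sub>E {0..int p - 1}) \<and>
      induced_fun (int p ^ n) (canonical_poly p n (l (fst sa)) (snd sa)) = F"
proof
  fix F assume F: "F \<in> Units (poly_fun_ring (int p ^ n))"
  let ?I = "{1..(p - 1) ^ p}" and ?A = "coeff_index p n \<rightarrow>\<^sub>E {0..int p - 1}"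
  let ?c = "\<lambda>s a. induced_fun (int p ^ n) (canonical_poly p n (l s) a)"
  have n: "n \<ge> 1" using assms(2) by simp
  have img: "l ` ?I = unit_reduced_polys p" and inj: "inj_on l ?I"
    using assms(3) by (auto simp: bij_betw_def)
  have "F \<in> carrier (poly_fun_ring (int p ^ n))" using F by (simp add: Units_def)
  then obtain f where f: "F = induced_fun (int p ^ n) f" by (auto simp: poly_fun_ring_def)
  obtain h a where h: "h \<in> unit_reduced_polys p" and a: "a \<in> ?A"
    and eq: "induced_fun (int p ^ n) (canonical_poly p n h a) = F"
    using canonical_poly_exists[OF assms(1) n F[unfolded f]] f by blast
  obtain s where s: "s \<in> ?I" "h = l s" using h img by blast
  show "\<exists>!sa. sa \<in> ?I \<times> ?A \<and> ?c (fst sa) (snd sa) = F"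
  proof (rule ex1I[of _ "(s, a)"])
    show "(s, a) \<in> ?I \<times> ?A \<and> ?c (fst (s, a)) (snd (s, a)) = F"
      using s a eq by simp
  next
    fix sa assume sa: "sa \<in> ?I \<times> ?A \<and> ?c (fst sa) (snd sa) = F"
    obtain s' a' where [simp]: "sa = (s', a')" by (cases sa)
    have s': "s' \<in> ?I" "a' \<in> ?A" "?c s' a' = F" using sa by auto
    have "l s' \<in> reduced_polys p" "l s \<in> reduced_polys p"
      using img s(1) s'(1) by (auto simp: unit_reduced_polys_def)
    hence "l s' = l s \<and> a' = a"
      using canonical_poly_unique[OF assms(1) n _ _ s'(2) a] s'(3) eq s(2) by simp
    \<comment> \<open>Injectivity of the enumeration \<open>l\<close> turns equality of polynomials
      into equality of indices.\<close>
    thus "sa = (s, a)" using inj_onD[OF inj] s'(1) s(1) by simp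
  qed
qed

end
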